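(* Let $k\ge 0$ be an integer, let $p_1,\dots,p_k$ be distinct primes, and let $\Gamma_k$ be the $k$-dprime divisor function graph of $n=p_1p_2\cdots p_k$. Then the Harary index of $\Gamma_k$ is $$H(\Gamma_k)=\frac{2^{k-1}(2^k-3)+3^k}{2}.$$
   Context: For $n=p_1p_2\cdots p_k$ with $p_1,\dots,p_k$ distinct primes, the $k$-dprime divisor function graph $\Gamma_k=G_{D(n)}$ is the simple graph with vertex set $V(\Gamma_k)=\{u\in\mathbb{Z}_{>0}: u\mid n\}$ and edge set $E(\Gamma_k)=\{uv: u\neq v,\ u\mid v \text{ or } v\mid u\}$. The Harary index is $H(\Gamma_k)=\sum_{\{u,v\}\subseteq V(\Gamma_k)} \frac{1}{d_{\Gamma_k}(u,v)}$, summed over unordered pairs of distinct vertices, where $d_{\Gamma_k}$ is the shortest-path distance. *)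

theory Defs
  imports "HOL-Computational_Algebra.Primes" "Graph_Theory.Graph_Theory"
begin

text \<open>
  Simple graphs are the finite symmetric loop-free digraphs without parallel arcs of
  \<^locale>\<open>graph\<close>: an undirected edge \<open>uv\<close> is the pair of arcs \<open>(u, v)\<close> and \<open>(v, u)\<close>.
\<close>

definition divisor_graph :: "nat \<Rightarrow> nat pair_pre_digraph" where
  "divisor_graph n =
     \<lparr> pverts = {u. 0 < u \<and> u dvd n},
       parcs = {(u, v). 0 < u \<and> u dvd n \<and> 0 < v \<and> v dvd n \<and> u \<noteq> v \<and> (u dvd v \<or> v dvd u)} \<rparr>"

lemma divisor_graph_graph:
  assumes "n > 0"
  shows "graph (with_proj (divisor_graph n))"
proof -
  have fin: "finite {u. 0 < u \<and> u dvd n}"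
    using finite_divisors_nat[OF assms] by (rule rev_finite_subset) auto
  have "finite (parcs (divisor_graph n))"
    by (rule finite_subset[OF _ finite_cartesian_product[OF fin fin]])
      (auto simp: divisor_graph_def)
  with fin show ?thesis
    by unfold_locales (auto simp: divisor_graph_def symmetric_def sym_def arc_to_ends_def)
qed

text \<open>
  The number of arcs of a shortest walk. Between disconnected vertices the infimum is
  \<open>\<infinity>\<close>, which is sent to \<open>0\<close>; with \<open>1 / 0 = 0\<close> such pairs then contribute \<open>0\<close> to the Harary
  index, as usual.
\<close>

definition graph_dist :: "('a, 'b) pre_digraph \<Rightarrow> 'a \<Rightarrow> 'a \<Rightarrow> real" where
  "graph_dist G u v = real_of_ereal (wf_digraph.\<mu> G (\<lambda>_. 1) u v)"

text \<open>
  An unordered pair of distinct vertices is represented by its unique increasing ordering;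
  on symmetric digraphs the summand does not depend on the order.
\<close>

definition harary_index :: "('a::linorder, 'b) pre_digraph \<Rightarrow> real" where
  "harary_index G =
     (\<Sum>(u, v) \<in> {(u, v). u \<in> verts G \<and> v \<in> verts G \<and> u < v}. 1 / graph_dist G u v)"

end

theory Submission
  imports Defs "HOL-Computational_Algebra.Squarefree"
begin

text \<open>
  Two distinct divisors of \<open>n\<close> are at distance 1 if one divides the other, and otherwise at
  distance 2 through the common neighbour 1. Hence the Harary index is the mean of the number of
  pairs of divisors and the number of edges. Taking prime factors identifies the divisors of a
  squarefree \<open>n\<close> having \<open>k\<close> prime factors with the subsets of a \<open>k\<close>-set, and divisibility with
  inclusion, so there are \<open>2 ^ k\<close> vertices and \<open>3 ^ k\<close> pairs with \<open>u dvd v\<close>, of which \<open>2 ^ k\<close>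
  have \<open>u = v\<close>.
\<close>

section \<open>Distances\<close>

text \<open>Under unit weights the cost of a walk is its length, so the infimum defining
  \<open>\<mu>\<close> is attained at a shortest walk. It is then finite, and
  \<open>real_of_ereal\<close> keeps its value.\<close>

lemma (in wf_digraph) graph_dist_eq_length:
  assumes p: "awalk u p v" and min: "\<And>q. awalk u q v \<Longrightarrow> length p \<le> length q"
  shows "graph_dist G u v = length p"
proof -
  have cost: "awalk_cost (\<lambda>_. 1) q = length q" for q
    by (induction q) auto
  have "\<mu> (\<lambda>_. 1) u v = ereal (length p)"
    unfolding \<mu>_def cost
    by (rule antisym) (use p min in \<open>auto intro!: INF_lower2[of p] INF_greatest\<close>)
  then show ?thesis
    by (simp add: graph_dist_def)
qed

lemma (in wf_digraph) graph_dist_arc: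
  assumes "e \<in> arcs G" "tail G e \<noteq> head G e"
  shows "graph_dist G (tail G e) (head G e) = 1"
proof -
  have "length [e] \<le> length q" if "awalk (tail G e) q (head G e)" for q
    using that assms(2) by (cases q) (auto simp: awalk_Nil_iff)
  from graph_dist_eq_length[OF arc_implies_awalk[OF assms(1)] this] show ?thesis
    by simp
qed

text \<open>The empty walk would make the end points equal, and a walk of one arc would join them
  directly; both are excluded.\<close>

lemma (in wf_digraph) graph_dist_two_arcs:
  assumes e: "e \<in> arcs G" "e' \<in> arcs G" "head G e = tail G e'"
    and "tail G e \<noteq> head G e'" "(tail G e, head G e') \<notin> arcs_ends G"
  shows "graph_dist G (tail G e) (head G e') = 2"
proof -
  have "awalk (tail G e) [e, e'] (head G e')"
    using e by (simp add: awalk_Cons_iff awalk_Nil_iff)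
  moreover have "length [e, e'] \<le> length q" if q: "awalk (tail G e) q (head G e')" for q
  proof (cases q)
    case Nil
    with q assms(4) show ?thesis
      by (simp add: awalk_Nil_iff)
  next
    case (Cons a r)
    with q assms(5) have "r \<noteq> []"
      by (auto simp: awalk_Cons_iff awalk_Nil_iff arcs_ends_conv)
    with Cons show ?thesis
      by (cases r) auto
  qed
  ultimately show ?thesis
    using graph_dist_eq_length by fastforce
qed

lemma graph_dist_divisor_graph:
  assumes "n > 0" "u dvd n" "v dvd n" "u < v"
  shows "graph_dist (with_proj (divisor_graph n)) u v = (if u dvd v then 1 else 2)"
proof -
  interpret graph "with_proj (divisor_graph n)"
    using \<open>n > 0\<close> by (rule divisor_graph_graph)
  have pos: "u > 0" "v > 0"
    using assms by (auto intro!: gr0I)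
  have not_dvd: "\<not> v dvd u"
    using \<open>u < v\<close> pos by (auto dest: dvd_imp_le)
  show ?thesis
  proof (cases "u dvd v")
    case True
    then show ?thesis
      using graph_dist_arc[of "(u, v)"] assms pos by (simp add: divisor_graph_def)
  next
    \<comment> \<open>Since 1 divides everything, incomparable \<open>u\<close> and \<open>v\<close>
      both differ from 1, so the arcs to and from 1 are not loops.\<close>
    case False
    then have "u \<noteq> 1" "v \<noteq> 1"
      using not_dvd by auto
    then show ?thesis
      using graph_dist_two_arcs[of "(u, 1)" "(1, v)"] assms pos False not_dvd
      by (simp add: divisor_graph_def)
  qed
qed

section \<open>Divisors of squarefree numbers\<close>

lemma prod_prime_factors_squarefree:
  fixes n :: nat
  assumes "squarefree n"
  shows "\<Prod>(prime_factors n) = n"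
proof -
  have "n \<noteq> 0"
    using assms by (metis not_squarefree_0)
  then have "n = (\<Prod>p\<in>prime_factors n. p ^ multiplicity p n)"
    by (simp add: prime_factorization_nat)
  also have "\<dots> = \<Prod>(prime_factors n)"
    using assms squarefree_factorial_semiring'[OF \<open>n \<noteq> 0\<close>] by (intro prod.cong) auto
  finally show ?thesis ..
qed

text \<open>The inverse is \<open>Prod\<close>. It recovers a divisor from its prime factors because
  divisors of a squarefree number are again squarefree.\<close>

lemma bij_betw_prime_factors_squarefree:
  fixes n :: nat
  assumes "squarefree n"
  shows "bij_betw prime_factors {d. d dvd n} (Pow (prime_factors n))"
proof (rule bij_betwI[where g = Prod])
  have "n \<noteq> 0"
    using assms by (metis not_squarefree_0)
  then show "prime_factors \<in> {d. d dvd n} \<rightarrow> Pow (prime_factors n)"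
    using dvd_prime_factors by blast
  show "Prod \<in> Pow (prime_factors n) \<rightarrow> {d. d dvd n}"
    using prod_dvd_prod_subset[of "prime_factors n" _ "\<lambda>p. p"]
    by (auto simp: prod_prime_factors_squarefree[OF assms])
  show "\<Prod>(prime_factors d) = d" if "d \<in> {d. d dvd n}" for d
    using that assms by (auto intro: prod_prime_factors_squarefree squarefree_mono)
  show "prime_factors (\<Prod>P) = P" if "P \<in> Pow (prime_factors n)" for P
  proof -
    from that have "finite P" "\<And>p. p \<in> P \<Longrightarrow> prime p"
      by (auto intro: finite_subset)
    moreover from this have "0 \<notin> P"
      using not_prime_0 by blast
    ultimately show ?thesis
      by (subst prime_factors_prod) (auto simp: prime_prime_factors)
  qed
qed

lemma card_divisors_squarefree:
  fixes n :: nat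
  assumes "squarefree n"
  shows "card {d. d dvd n} = 2 ^ card (prime_factors n)"
  using bij_betw_same_card[OF bij_betw_prime_factors_squarefree[OF assms]]
  by (simp add: card_Pow)

text \<open>Expand the product of \<open>x + 1\<close> over \<open>A\<close>: each subset
  \<open>S\<close> records the factors from which \<open>x\<close> is chosen.\<close>

lemma sum_power_card_Pow:
  fixes x :: "'a :: comm_semiring_1"
  assumes "finite A"
  shows "(\<Sum>S\<in>Pow A. x ^ card S) = (x + 1) ^ card A"
  using prod_add[OF assms, of "\<lambda>_. x" "\<lambda>_. 1"] by simp

lemma card_dvd_pairs_squarefree:
  fixes n :: nat
  assumes "squarefree n"
  shows "card {(u, v). u dvd v \<and> v dvd n} = 3 ^ card (prime_factors n)"
proof -
  have "n > 0"
    using assms by (metis not_squarefree_0 gr0I)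
  \<comment> \<open>Swapping the coordinates lets the pairs be counted by their larger member
    \<open>v\<close>, itself squarefree and so with \<open>2 ^ card (prime_factors v)\<close>
    divisors.\<close>
  have "{(u, v). u dvd v \<and> v dvd n} = (\<lambda>(v, u). (u, v)) ` (SIGMA v:{v. v dvd n}. {u. u dvd v})"
    by auto
  then have "card {(u, v). u dvd v \<and> v dvd n} = card (SIGMA v:{v. v dvd n}. {u. u dvd v})"
    by (simp add: card_image inj_on_def)
  also have "\<dots> = (\<Sum>v | v dvd n. card {u. u dvd v})"
    using \<open>n > 0\<close> by (intro card_SigmaI) (auto intro!: finite_divisors_nat intro: dvd_pos_nat)
  also have "\<dots> = (\<Sum>v | v dvd n. 2 ^ card (prime_factors v))"
    using assms by (intro sum.cong) (auto intro: card_divisors_squarefree squarefree_mono)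
  also have "\<dots> = (\<Sum>S\<in>Pow (prime_factors n). 2 ^ card S)"
    by (rule sum.reindex_bij_betw[OF bij_betw_prime_factors_squarefree[OF assms]])
  also have "\<dots> = 3 ^ card (prime_factors n)"
    by (simp add: sum_power_card_Pow)
  finally show ?thesis .
qed

section \<open>The Harary index\<close>

text \<open>The square \<open>A \<times> A\<close> splits into the pairs above the diagonal, their
  converses, and the diagonal.\<close>

lemma card_less_pairs:
  fixes A :: "'a :: linorder set"
  assumes "finite A"
  shows "2 * card {(u, v). u \<in> A \<and> v \<in> A \<and> u < v} + card A = card A ^ 2"
proof -
  define L where "L = {(u, v). u \<in> A \<and> v \<in> A \<and> u < v}"
  have fin: "finite L"
    by (rule finite_subset[of _ "A \<times> A"]) (use assms in \<open>auto simp: L_def\<close>)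
  have "A \<times> A = (L \<union> L\<inverse>) \<union> Id_on A"
    by (auto simp: L_def Id_on_iff not_less_iff_gr_or_eq)
  then have "card A ^ 2 = card ((L \<union> L\<inverse>) \<union> Id_on A)"
    by (metis card_cartesian_product power2_eq_square)
  also have "\<dots> = card (L \<union> L\<inverse>) + card (Id_on A)"
    using fin assms by (intro card_Un_disjoint) (auto simp: L_def Id_on_def)
  also have "card (L \<union> L\<inverse>) = card L + card (L\<inverse>)"
    using fin by (intro card_Un_disjoint) (auto simp: L_def)
  also have "card (Id_on A) = card A"
    by (simp add: Id_on_def UNION_singleton_eq_range card_image inj_on_def)
  finally show ?thesis
    by (simp add: L_def)
qed

lemma harary_index_divisor_graph:
  assumes "n > 0"
  shows "harary_index (with_proj (divisor_graph n)) =
    (card {(u, v). u dvd n \<and> v dvd n \<and> u < v} + card {(u, v). u dvd v \<and> v dvd n \<and> u < v}) / 2"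
proof -
  define L where "L = {(u, v). u dvd n \<and> v dvd n \<and> u < v}"
  have fin: "finite L"
    by (rule finite_subset[of _ "{u. u dvd n} \<times> {u. u dvd n}"])
      (use assms in \<open>auto simp: L_def finite_divisors_nat\<close>)
  have "harary_index (with_proj (divisor_graph n))
      = (\<Sum>(u, v)\<in>L. 1 / graph_dist (with_proj (divisor_graph n)) u v)"
    unfolding harary_index_def
    by (rule sum.cong) (use assms in \<open>auto simp: divisor_graph_def L_def intro: dvd_pos_nat\<close>)
  \<comment> \<open>The reciprocal distance is 1 or 1/2 according to whether \<open>u dvd v\<close>;
    this form separates the count of all pairs from that of the edges.\<close>
  also have "\<dots> = (\<Sum>(u, v)\<in>L. (1 + of_bool (u dvd v)) / 2)"
    by (rule sum.cong) (use assms in \<open>auto simp: L_def graph_dist_divisor_graph\<close>)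
  also have "\<dots> = (real (card L) + (\<Sum>x\<in>L. of_bool (fst x dvd snd x))) / 2"
    by (simp add: case_prod_beta sum.distrib flip: sum_divide_distrib)
  also have "(\<Sum>x\<in>L. of_bool (fst x dvd snd x)) = real (card (L \<inter> {x. fst x dvd snd x}))"
    using fin by simp
  also have "L \<inter> {x. fst x dvd snd x} = {(u, v). u dvd v \<and> v dvd n \<and> u < v}"
    by (auto simp: L_def)
  finally show ?thesis
    by (simp add: L_def)
qed

lemma card_strict_dvd_pairs:
  fixes n :: nat
  assumes "n > 0"
  shows "card {(u, v). u dvd v \<and> v dvd n \<and> u < v} + card {d. d dvd n}
    = card {(u, v). u dvd v \<and> v dvd n}"
proof -
  have fin: "finite {d. d dvd n}"
    using assms by (simp add: finite_divisors_nat)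
  \<comment> \<open>On positive numbers divisibility refines the usual order, so the non-strict
    pairs are the strict ones plus the diagonal.\<close>
  have "u < v \<or> u = v" if "u dvd v" "v dvd n" for u v
    using dvd_imp_le[OF that(1) dvd_pos_nat[OF assms that(2)]] by auto
  then have "{(u, v). u dvd v \<and> v dvd n}
      = {(u, v). u dvd v \<and> v dvd n \<and> u < v} \<union> Id_on {d. d dvd n}"
    by (auto simp: Id_on_iff)
  moreover have "{(u, v). u dvd v \<and> v dvd n \<and> u < v} \<subseteq> {d. d dvd n} \<times> {d. d dvd n}"
    by (blast intro: dvd_trans)
  then have "finite {(u, v). u dvd v \<and> v dvd n \<and> u < v}"
    using fin finite_subset by blast
  moreover have "card (Id_on {d. d dvd n}) = card {d. d dvd n}"
    by (simp add: Id_on_def UNION_singleton_eq_range card_image inj_on_def)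
  ultimately show ?thesis
    using fin by (simp add: card_Un_disjoint Id_on_def disjoint_iff)
qed

lemma harary_index_divisor_graph_squarefree:
  fixes n :: nat
  assumes "squarefree n"
  defines "k \<equiv> card (prime_factors n)"
  shows "harary_index (with_proj (divisor_graph n))
    = (2 powi (int k - 1) * (2 ^ k - 3) + 3 ^ k) / 2"
proof -
  define a b where "a = card {(u, v). u dvd n \<and> v dvd n \<and> u < v}"
    and "b = card {(u, v). u dvd v \<and> v dvd n \<and> u < v}"
  have "n > 0"
    using assms by (metis not_squarefree_0 gr0I)
  have "2 * a + 2 ^ k = (2 ^ k)\<^sup>2"
    using card_less_pairs[of "{d. d dvd n}"] \<open>n > 0\<close>
    by (simp add: a_def k_def card_divisors_squarefree[OF assms(1)])
  \<comment> \<open>The counts are moved to the reals while still in additive form, which avoids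
    truncated subtraction.\<close>
  then have "2 * real a + 2 ^ k = (2 ^ k)\<^sup>2"
    by (metis (mono_tags) of_nat_add of_nat_mult of_nat_numeral of_nat_power)
  moreover have "b + 2 ^ k = 3 ^ k"
    using card_strict_dvd_pairs[OF \<open>n > 0\<close>]
    by (simp add: b_def k_def card_divisors_squarefree card_dvd_pairs_squarefree assms(1))
  then have "real b + 2 ^ k = 3 ^ k"
    by (metis (mono_tags) of_nat_add of_nat_numeral of_nat_power)
  \<comment> \<open>The integer exponent covers \<open>k = 0\<close> as well, where the power is 1/2
    and the index is 0.\<close>
  moreover have "(2 :: real) powi (int k - 1) = 2 ^ k / 2"
    by (simp add: power_int_diff)
  moreover have "harary_index (with_proj (divisor_graph n)) = (real a + real b) / 2"
    using harary_index_divisor_graph[OF \<open>n > 0\<close>] by (simp add: a_def b_def)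
  ultimately show ?thesis
    by (simp only:) (simp add: field_simps power2_eq_square)
qed

theorem theorem3p5:
  fixes k :: nat and p :: "nat \<Rightarrow> nat"
  assumes "\<And>i. i \<in> {1..k} \<Longrightarrow> prime (p i)"
    and "inj_on p {1..k}"
  shows "harary_index (with_proj (divisor_graph (\<Prod>i=1..k. p i)))
    = (2 powi (int k - 1) * (2 ^ k - 3) + 3 ^ k) / 2"
proof -
  have "squarefree (\<Prod>i=1..k. p i)"
    using assms
    by (intro squarefree_prod_coprime)
      (auto intro!: primes_coprime squarefree_prime dest: inj_onD)
  \<comment> \<open>With all factors nonzero, the prime factors of the product are the union of
    theirs, here the singletons of the \<open>p i\<close>; injectivity of \<open>p\<close> then
    gives \<open>k\<close> of them.\<close>
  moreover have "0 \<notin> p ` {1..k}"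
    using assms(1) not_prime_0 by (metis imageE)
  then have "prime_factors (\<Prod>i=1..k. p i) = (\<Union>i\<in>{1..k}. prime_factors (p i))"
    by (subst prime_factors_prod) auto
  then have "prime_factors (\<Prod>i=1..k. p i) = p ` {1..k}"
    using assms(1) by (auto simp: prime_prime_factors)
  then have "card (prime_factors (\<Prod>i=1..k. p i)) = k"
    using assms(2) by (simp add: card_image)
  ultimately show ?thesis
    using harary_index_divisor_graph_squarefree[of "\<Prod>i=1..k. p i"] by simp
qed

end
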